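(* Suppose that the response mechanism is $\operatorname{logit}\{P(\delta=1\mid \boldsymbol{x},y;\boldsymbol{\alpha},\beta)\}=h(\boldsymbol{x};\boldsymbol{\alpha})+\beta y$, and that the distribution of $[y\mid\boldsymbol{x},\delta=1]$ is identifiable and has the normal mixture density $$[y\mid\boldsymbol{x},\delta=1;\boldsymbol{\gamma}]\sim\sum_{k=1}^{K}\pi_k N\big(\mu_k(\boldsymbol{x};\boldsymbol{\kappa}_k),\sigma_k^2\big),$$ where $h(\boldsymbol{x};\boldsymbol{\alpha})=\sum_{j=0}^{J-1}\alpha_j h_j(\boldsymbol{x})$ and $\mu_k(\boldsymbol{x};\boldsymbol{\kappa}_k)=\sum_{l=0}^{m(k)}\eta_{lk}(\boldsymbol{x})\kappa_{lk}$, and the basis functions $h_j$ and $\eta_{lk}$ are monomials in the coordinates of $\boldsymbol{x}$. With $\mathcal{M}$ and $\mu_k^{\mathcal{M}}$ as defined in the context, consider the conditions: (C1) the distribution of $\boldsymbol{x}$ is continuous; (C2) $\mathcal{M}\neq\emptyset$; (C3) the sign of $\beta$ is known; (C4) $\{\mu_i^{\mathcal{M}}(\boldsymbol{x};\boldsymbol{\kappa}_i);\ i=1,\ldots,K\}\neq\{-\mu_i^{\mathcal{M}}(\boldsymbol{x};\boldsymbol{\kappa}_i);\ i=1,\ldots,K\}$. Then the model is identifiable if (C1) and (C2) hold and one of (C3) and (C4) holds.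
   Context: $(\boldsymbol{x},y,\delta)$ are random variables: $\boldsymbol{x}$ is a vector of fully observed covariates, $y$ is a response variable subject to missingness, and $\delta$ is the response indicator for $y$ ($\delta=1$ if $y$ is observed, $\delta=0$ if it is missing). $\operatorname{logit}(z)=\log\{z/(1-z)\}$ for $0<z<1$. The function $h(\boldsymbol{x};\boldsymbol{\alpha})$ is known up to the finite-dimensional parameter $\boldsymbol{\alpha}$ (of dimension $J$) and is injective with respect to $\boldsymbol{\alpha}$. The parameter $\boldsymbol{\gamma}$ collects $\boldsymbol{\kappa}=(\boldsymbol{\kappa}_1^\top,\ldots,\boldsymbol{\kappa}_K^\top)^\top$ with $\boldsymbol{\kappa}_k=(\kappa_{0k},\ldots,\kappa_{m(k)k})^\top$, the variances $(\sigma_1^2,\ldots,\sigma_K^2)$, the mixing proportions $(\pi_1,\ldots,\pi_K)$ with $\pi_k\ge 0$ and $\sum_{k=1}^{K}\pi_k=1$, and $K$. Identifiability of $[y\mid\boldsymbol{x},\delta=1]$ means that its conditional density $f(y\mid\boldsymbol{x},\delta=1;\boldsymbol{\gamma})$ determines $\boldsymbol{\gamma}$. Each basis function $h_j(\boldsymbol{x})$ and $\eta_{lk}(\boldsymbol{x})$ has the form $\prod_{i=1}^{\dim(\boldsymbol{x})}x_i^{s_i}$, where $\dim(\boldsymbol{x})$ is the dimension of $\boldsymbol{x}$ and each $s_i$ is a nonnegative integer. Define $$\mathcal{H}=\{h_j(\boldsymbol{x}): j=0,1,\ldots,J-1\}\cup\{1\},\qquad \mathcal{M}=\{\eta_{lk}(\boldsymbol{x}):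 l=0,1,\ldots,m(k),\ k=1,\ldots,K\}\setminus\mathcal{H},$$ and decompose $\mu_k(\boldsymbol{x};\boldsymbol{\kappa}_k)=\mu_k^{\mathcal{H}}(\boldsymbol{x};\boldsymbol{\kappa}_k)+\mu_k^{\mathcal{M}}(\boldsymbol{x};\boldsymbol{\kappa}_k)$, where $\mu_k^{\mathcal{H}}$ and $\mu_k^{\mathcal{M}}$ consist of the terms of $\mu_k$ that are constant multiples of elements of $\mathcal{H}$ and of $\mathcal{M}$, respectively. (Example: $h=2+4x$, $\mu_1=3x^2$, $\mu_2=x+4x^3$ give $\mathcal{H}=\{1,x\}$, $\mathcal{M}=\{x^2,x^3\}$, $\mu_1^{\mathcal{H}}=0$, $\mu_1^{\mathcal{M}}=3x^2$, $\mu_2^{\mathcal{H}}=x$, $\mu_2^{\mathcal{M}}=4x^3$.) The conditional density $f(y\mid\boldsymbol{x};\boldsymbol{\alpha},\beta,\boldsymbol{\gamma})$ of $y$ given $\boldsymbol{x}$ is the one determined, through Bayes' theorem, by the response mechanism and the respondents' density: $$P(\delta=1\mid\boldsymbol{x},y;\boldsymbol{\alpha},\beta)\,f(y\mid\boldsymbol{x};\boldsymbol{\alpha},\beta,\boldsymbol{\gamma})=\frac{f(y\mid\boldsymbol{x},\delta=1;\boldsymbol{\gamma})}{\int f(u\mid\boldsymbol{x},\delta=1;\boldsymbol{\gamma})\{P(\delta=1\mid\boldsymbol{x},u;\boldsymbol{\alpha},\beta)\}^{-1}\,du}.$$ The model is called identifiable if $$P(\delta=1\mid\boldsymbol{x},y;\boldsymbol{\alpha},\beta)f(y\mid\boldsymbol{x};\boldsymbol{\alpha},\beta,\boldsymbol{\gamma})=P(\delta=1\mid\boldsymbol{x},y;\boldsymbol{\alpha}',\beta')f(y\mid\boldsymbol{x};\boldsymbol{\alpha}',\beta',\boldsymbol{\gamma}')$$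 with probability 1 implies $(\boldsymbol{\alpha}^\top,\beta,\boldsymbol{\gamma}^\top)=(\boldsymbol{\alpha}'^\top,\beta',\boldsymbol{\gamma}'^\top)$.
   Formalization: Added: every mixing proportion π_k (k=1..K) is nonzero, and for each γ in the parameter space some μ_k^M is not identically zero; without these (e.g. π=(1,0), or K=1 with zero coefficient on the only monomial in M) the claim fails. *)

theory Defs
  imports "HOL-Probability.Probability"
begin

definition logit :: "real \<Rightarrow> real" where
  "logit z = ln (z / (1 - z))"

definition monomial :: "(real^'d \<Rightarrow> real) \<Rightarrow> bool" where
  "monomial b \<longleftrightarrow> (\<exists>s :: 'd \<Rightarrow> nat. b = (\<lambda>x. \<Prod>i\<in>UNIV. (x $ i) ^ s i))"

text \<open>The parameter of the normal mixture. The number of components is part of the parameter.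
  Components are numbered from 1, and \<open>kappa \<gamma> l k\<close> is the coefficient of the \<open>l\<close>-th basis
  function, \<open>l = 0, \<dots>, m k\<close>, in the mean of component \<open>k\<close>.\<close>

record mixture_param =
  ncomp :: nat
  kappa :: "nat \<Rightarrow> nat \<Rightarrow> real"
  sigma2 :: "nat \<Rightarrow> real"
  mixp :: "nat \<Rightarrow> real"

text \<open>The entries beyond the index ranges carry no information. They are fixed to be 0, so that
  equality of records is equality of parameters.\<close>

definition mixture_param_space :: "(nat \<Rightarrow> nat) \<Rightarrow> mixture_param set" where
  "mixture_param_space m = {\<gamma>.
     (\<forall>k\<in>{1..ncomp \<gamma>}. sigma2 \<gamma> k > 0 \<and> mixp \<gamma> k \<ge> 0) \<and>
     (\<Sum>k=1..ncomp \<gamma>. mixp \<gamma> k) = 1 \<and>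
     (\<forall>k. k \<notin> {1..ncomp \<gamma>} \<longrightarrow> sigma2 \<gamma> k = 0 \<and> mixp \<gamma> k = 0) \<and>
     (\<forall>k l. \<not> (k \<in> {1..ncomp \<gamma>} \<and> l \<le> m k) \<longrightarrow> kappa \<gamma> l k = 0)}"

definition lin_pred :: "('j::finite \<Rightarrow> real^'d \<Rightarrow> real) \<Rightarrow> real^'j \<Rightarrow> real^'d \<Rightarrow> real" where
  "lin_pred h \<alpha> x = (\<Sum>j\<in>UNIV. \<alpha> $ j * h j x)"

definition comp_mean ::
  "(nat \<Rightarrow> nat \<Rightarrow> real^'d \<Rightarrow> real) \<Rightarrow> (nat \<Rightarrow> nat) \<Rightarrow> mixture_param \<Rightarrow> nat \<Rightarrow> real^'d \<Rightarrow> real" where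
  "comp_mean \<eta> m \<gamma> k x = (\<Sum>l=0..m k. \<eta> l k x * kappa \<gamma> l k)"

definition resp_density ::
  "(nat \<Rightarrow> nat \<Rightarrow> real^'d \<Rightarrow> real) \<Rightarrow> (nat \<Rightarrow> nat) \<Rightarrow> mixture_param \<Rightarrow> real^'d \<Rightarrow> real \<Rightarrow> real" where
  "resp_density \<eta> m \<gamma> x y =
     (\<Sum>k=1..ncomp \<gamma>. mixp \<gamma> k * normal_density (comp_mean \<eta> m \<gamma> k x) (sqrt (sigma2 \<gamma> k)) y)"

definition basis_H :: "('j \<Rightarrow> real^'d \<Rightarrow> real) \<Rightarrow> (real^'d \<Rightarrow> real) set" where
  "basis_H h = range h \<union> {\<lambda>x. 1}"

definition basis_M ::
  "('j \<Rightarrow> real^'d \<Rightarrow> real) \<Rightarrow> (nat \<Rightarrow> nat \<Rightarrow> real^'d \<Rightarrow> real) \<Rightarrow> (nat \<Rightarrow> nat) \<Rightarrow> nat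
     \<Rightarrow> (real^'d \<Rightarrow> real) set" where
  "basis_M h \<eta> m K = {\<eta> l k | l k. l \<in> {0..m k} \<and> k \<in> {1..K}} - basis_H h"

definition comp_mean_M ::
  "('j \<Rightarrow> real^'d \<Rightarrow> real) \<Rightarrow> (nat \<Rightarrow> nat \<Rightarrow> real^'d \<Rightarrow> real) \<Rightarrow> (nat \<Rightarrow> nat) \<Rightarrow> mixture_param
     \<Rightarrow> nat \<Rightarrow> real^'d \<Rightarrow> real" where
  "comp_mean_M h \<eta> m \<gamma> k x =
     (\<Sum>l\<in>{l\<in>{0..m k}. \<eta> l k \<in> basis_M h \<eta> m (ncomp \<gamma>)}. \<eta> l k x * kappa \<gamma> l k)"

text \<open>The conditional density of \<open>y\<close> given \<open>x\<close>, from the respondents' density \<open>g\<close> and the response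
  probability \<open>P\<close>. By Bayes' theorem \<open>P x y * f x y = g x y / (\<integral>u. g x u / P x u)\<close>.\<close>

definition cond_density ::
  "('x \<Rightarrow> real \<Rightarrow> real) \<Rightarrow> ('x \<Rightarrow> real \<Rightarrow> real) \<Rightarrow> 'x \<Rightarrow> real \<Rightarrow> real" where
  "cond_density P g x y = g x y / P x y / (LINT u|lborel. g x u / P x u)"

definition joint_law :: "'x measure \<Rightarrow> ('x \<Rightarrow> real \<Rightarrow> real) \<Rightarrow> ('x \<times> real) measure" where
  "joint_law D f = density (D \<Otimes>\<^sub>M lborel) (\<lambda>(x, y). ennreal (f x y))"

definition continuous_distribution :: "'a::euclidean_space measure \<Rightarrow> bool" where
  "continuous_distribution D \<longleftrightarrow> (\<exists>p \<in> borel_measurable lborel. D = density lborel p)"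

definition resp_identifiable ::
  "'x measure \<Rightarrow> ('g \<Rightarrow> 'x \<Rightarrow> real \<Rightarrow> real) \<Rightarrow> 'g set \<Rightarrow> bool" where
  "resp_identifiable D g \<Gamma> \<longleftrightarrow>
     (\<forall>\<gamma>\<in>\<Gamma>. \<forall>\<gamma>'\<in>\<Gamma>. (AE (x, y) in D \<Otimes>\<^sub>M lborel. g \<gamma> x y = g \<gamma>' x y) \<longrightarrow> \<gamma> = \<gamma>')"

text \<open>The probability in ``with probability 1'' is the law of \<open>(x, y)\<close> under the parameter
  \<open>(\<alpha>, \<beta>, \<gamma>)\<close>.\<close>

definition model_identifiable ::
  "'x measure \<Rightarrow> ('a \<Rightarrow> real \<Rightarrow> 'x \<Rightarrow> real \<Rightarrow> real) \<Rightarrow> ('g \<Rightarrow> 'x \<Rightarrow> real \<Rightarrow> real)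
     \<Rightarrow> 'a set \<Rightarrow> real set \<Rightarrow> 'g set \<Rightarrow> bool" where
  "model_identifiable D P g A B \<Gamma> \<longleftrightarrow>
     (\<forall>\<alpha>\<in>A. \<forall>\<beta>\<in>B. \<forall>\<gamma>\<in>\<Gamma>. \<forall>\<alpha>'\<in>A. \<forall>\<beta>'\<in>B. \<forall>\<gamma>'\<in>\<Gamma>.
        (AE (x, y) in joint_law D (cond_density (P \<alpha> \<beta>) (g \<gamma>)).
            P \<alpha> \<beta> x y * cond_density (P \<alpha> \<beta>) (g \<gamma>) x y =
            P \<alpha>' \<beta>' x y * cond_density (P \<alpha>' \<beta>') (g \<gamma>') x y) \<longrightarrow>
        (\<alpha>, \<beta>, \<gamma>) = (\<alpha>', \<beta>', \<gamma>'))"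

end

theory Submission
  imports Defs "HOL-Complex_Analysis.Conformal_Mappings"
begin

text \<open>By Bayes' theorem \<open>P f = g / C\<close> with \<open>C = 1 + exp (- h) \<Sum>\<^sub>k \<pi>\<^sub>k exp (- \<beta> \<mu>\<^sub>k + \<beta>\<^sup>2 \<sigma>\<^sub>k\<^sup>2 / 2)\<close>.
  Integrating over \<open>y\<close>, equality of \<open>P f\<close> under two parameters gives equality of \<open>C\<close> and then of \<open>g\<close>,
  hence of \<open>\<gamma>\<close>. The two functions \<open>C\<close> are sums of exponentials of polynomials in \<open>x\<close>. They agree on a
  set of positive Lebesgue measure, so they agree everywhere. Exponentials of polynomials that differ by more than
  a constant are linearly independent and all coefficients are positive, so the exponents match up to constants.
  Comparing the coefficients of the monomials in \<open>\<M>\<close> gives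
  \<open>\<beta> {\<mu>\<^sub>k\<^sup>\<M>} = \<beta>' {\<mu>\<^sub>k\<^sup>\<M>}\<close> as sets of functions. Since some \<open>\<mu>\<^sub>k\<^sup>\<M>\<close> is nonzero, \<open>\<bar>\<beta>\<bar> = \<bar>\<beta>'\<bar>\<close>,
  and either (C3) or (C4) excludes \<open>\<beta>' = - \<beta> \<noteq> 0\<close>. Then the mixture factors of \<open>C\<close> cancel and \<open>h\<close> is determined.\<close>

section \<open>Real restrictions of entire functions and their zero sets\<close>

text \<open>Real analyticity in a form that passes directly through sums, products and
  \<open>exp\<close>, and that makes the identity theorem for holomorphic functions
  available.\<close>

definition real_entire :: "(real \<Rightarrow> real) \<Rightarrow> bool" where
  "real_entire f \<longleftrightarrow> (\<exists>g. g holomorphic_on UNIV \<and> (\<forall>t. g (complex_of_real t) = of_real (f t)))"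

lemma real_entire_const [intro, simp]: "real_entire (\<lambda>t. c)"
  unfolding real_entire_def by (rule exI[of _ "\<lambda>z. of_real c"]) auto

lemma real_entire_ident [intro, simp]: "real_entire (\<lambda>t. t)"
  unfolding real_entire_def by (rule exI[of _ "\<lambda>z. z"]) auto

lemma real_entire_add: "real_entire f \<Longrightarrow> real_entire g \<Longrightarrow> real_entire (\<lambda>t. f t + g t)"
  unfolding real_entire_def
proof (elim exE conjE)
  fix F G assume "F holomorphic_on UNIV" "\<forall>t. F (complex_of_real t) = of_real (f t)"
    "G holomorphic_on UNIV" "\<forall>t. G (complex_of_real t) = of_real (g t)"
  then show "\<exists>h. h holomorphic_on UNIV \<and> (\<forall>t. h (complex_of_real t) = of_real (f t + g t))"
    by (intro exI[of _ "\<lambda>z. F z + G z"]) (auto intro!: holomorphic_intros)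
qed

lemma real_entire_mult: "real_entire f \<Longrightarrow> real_entire g \<Longrightarrow> real_entire (\<lambda>t. f t * g t)"
  unfolding real_entire_def
proof (elim exE conjE)
  fix F G assume "F holomorphic_on UNIV" "\<forall>t. F (complex_of_real t) = of_real (f t)"
    "G holomorphic_on UNIV" "\<forall>t. G (complex_of_real t) = of_real (g t)"
  then show "\<exists>h. h holomorphic_on UNIV \<and> (\<forall>t. h (complex_of_real t) = of_real (f t * g t))"
    by (intro exI[of _ "\<lambda>z. F z * G z"]) (auto intro!: holomorphic_intros)
qed

lemma real_entire_exp: "real_entire f \<Longrightarrow> real_entire (\<lambda>t. exp (f t))"
  unfolding real_entire_def
proof (elim exE conjE)
  fix F assume "F holomorphic_on UNIV" "\<forall>t. F (complex_of_real t) = of_real (f t)"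
  then show "\<exists>h. h holomorphic_on UNIV \<and> (\<forall>t. h (complex_of_real t) = of_real (exp (f t)))"
    by (intro exI[of _ "\<lambda>z. exp (F z)"]) (auto intro!: holomorphic_intros simp: exp_of_real)
qed

lemma real_entire_sum: "(\<And>i. i \<in> I \<Longrightarrow> real_entire (f i)) \<Longrightarrow> real_entire (\<lambda>t. \<Sum>i\<in>I. f i t)"
  by (induction I rule: infinite_finite_induct) (auto intro: real_entire_add)

lemma real_entire_prod: "(\<And>i. i \<in> I \<Longrightarrow> real_entire (f i)) \<Longrightarrow> real_entire (\<lambda>t. \<Prod>i\<in>I. f i t)"
  by (induction I rule: infinite_finite_induct) (auto intro: real_entire_mult)

lemma real_entire_power: "real_entire f \<Longrightarrow> real_entire (\<lambda>t. f t ^ n)"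
  by (induction n) (auto intro: real_entire_mult)

text \<open>An entire function that is not identically zero has only countably many zeros, and a
  countable set of reals is Lebesgue null.\<close>

lemma real_entire_AE_nonzero:
  assumes "real_entire f" "f t0 \<noteq> 0"
  shows "AE t in lborel. f t \<noteq> 0"
proof -
  obtain g where g: "g holomorphic_on UNIV" "\<And>t. g (complex_of_real t) = of_real (f t)"
    using assms by (auto simp: real_entire_def)
  have "g \<noteq> (\<lambda>_. 0)"
    using g(2)[of t0] assms(2) by auto
  then have "countable {z. g z = 0}"
    using holomorphic_countable_equal_UNIV[OF g(1), of "\<lambda>_. 0"] by auto
  moreover have "complex_of_real ` {t. f t = 0} \<subseteq> {z. g z = 0}"
    using g(2) by auto
  ultimately have "countable (complex_of_real ` {t. f t = 0})"
    by (rule countable_subset[rotated])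
  then have "countable {t. f t = 0}"
    by (rule countable_image_inj_on) (auto simp: inj_on_def)
  then have "{t. f t = 0} \<in> null_sets lborel"
    by (rule countable_imp_null_set_lborel)
  then show ?thesis
    by (rule AE_I') auto
qed

text \<open>Fubini, one coordinate at a time: a function that is nonzero at one point of a coordinate line is
  nonzero almost everywhere on that line.\<close>

lemma AE_nonzero_if_entire_on_lines:
  fixes F :: "'a::euclidean_space \<Rightarrow> real"
  assumes [measurable]: "F \<in> borel_measurable borel"
    and entire: "\<And>x b. b \<in> Basis \<Longrightarrow> real_entire (\<lambda>t. F (x + t *\<^sub>R b))"
    and "F x0 \<noteq> 0"
  shows "AE x in lborel. F x \<noteq> 0"
proof -
  interpret product_sigma_finite "\<lambda>_::'a. lborel::real measure" ..
  \<comment> \<open>Induction on the set of coordinates in which \<open>x0\<close> is allowed to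
    move: the empty set is the hypothesis on \<open>x0\<close>, and \<open>Basis\<close> covers the
    whole space.\<close>
  have *: "AE f in (\<Pi>\<^sub>M b\<in>I. lborel). F (x0 + (\<Sum>b\<in>I. f b *\<^sub>R b)) \<noteq> 0"
    if "I \<subseteq> Basis" for I
  proof -
    from that have "finite I" by (rule finite_subset) simp
    from this that show ?thesis
    proof (induction I)
      case empty
      then show ?case using \<open>F x0 \<noteq> 0\<close> by simp
    next
      case (insert i I)
      \<comment> \<open>Null sets become vanishing integrals of \<open>?Z\<close>, so that the
        iterated integral over \<open>I\<close> and the new coordinate \<open>i\<close> can be
        used.\<close>
      let ?Z = "\<lambda>f. indicator {x. F x = 0} (x0 + (\<Sum>b\<in>insert i I. f b *\<^sub>R b)) :: ennreal"
      have meas: "?Z \<in> borel_measurable (\<Pi>\<^sub>M b\<in>insert i I. lborel)"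
        by measurable
      have "AE f in (\<Pi>\<^sub>M b\<in>I. lborel). F (x0 + (\<Sum>b\<in>I. f b *\<^sub>R b)) \<noteq> 0"
        using insert by simp
      then have "AE f in (\<Pi>\<^sub>M b\<in>I. lborel). (\<integral>\<^sup>+ t. ?Z (f(i := t)) \<partial>lborel) = 0"
      proof eventually_elim
        case (elim f)
        have upd: "(\<Sum>b\<in>insert i I. (f(i := t)) b *\<^sub>R b) = (\<Sum>b\<in>I. f b *\<^sub>R b) + t *\<^sub>R i" for t
        proof -
          have "(\<Sum>b\<in>I. (f(i := t)) b *\<^sub>R b) = (\<Sum>b\<in>I. f b *\<^sub>R b)"
            using insert by (intro sum.cong) auto
          then show ?thesis using insert by simp
        qed
        have "AE t in lborel. F ((x0 + (\<Sum>b\<in>I. f b *\<^sub>R b)) + t *\<^sub>R i) \<noteq> 0"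
          using insert.prems elim by (intro real_entire_AE_nonzero[of _ 0] entire) auto
        then have "AE t in lborel. ?Z (f(i := t)) = 0"
          unfolding upd by eventually_elim (simp add: add.assoc)
        then show ?case
          by (subst nn_integral_cong_AE[where v = "\<lambda>_. 0"]) simp_all
      qed
      then have "(\<integral>\<^sup>+ f. ?Z f \<partial>(\<Pi>\<^sub>M b\<in>insert i I. lborel)) = 0"
        unfolding product_nn_integral_insert[OF insert(1,2) meas]
        by (subst nn_integral_cong_AE[where v = "\<lambda>_. 0"]) simp_all
      then have "AE f in (\<Pi>\<^sub>M b\<in>insert i I. lborel). ?Z f = 0"
        by (subst (asm) nn_integral_0_iff_AE[OF meas])
      then show ?case
        by eventually_elim (auto simp: indicator_def)
    qed
  qed
  \<comment> \<open>Lebesgue measure is the image of the product measure under the coordinate map;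
    its translation invariance then removes the shift by \<open>x0\<close>.\<close>
  have "AE x in lborel. F (x0 + x) \<noteq> 0"
    by (subst lborel_eq, subst AE_distr_iff) (use *[of Basis] in auto)
  then show ?thesis
    by (subst lborel_distr_plus[of x0, symmetric], subst AE_distr_iff) auto
qed

section \<open>Exponentials of polynomials in one and several variables\<close>

text \<open>A polynomial with positive leading coefficient and positive degree is eventually at
  least its leading coefficient. Subtracting \<open>Z\<close> changes neither, so the bound holds
  for \<open>p - [:Z:]\<close> too.\<close>

lemma filterlim_poly_at_top:
  fixes p :: "real poly"
  assumes "degree p > 0" "lead_coeff p > 0"
  shows "filterlim (poly p) at_top at_top"
  unfolding filterlim_at_top
proof
  fix Z :: real
  have *: "degree (p - [:Z:]) = degree p" "lead_coeff (p - [:Z:]) = lead_coeff p"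
  proof -
    have "degree (p + - [:Z:]) = degree p" by (rule degree_add_eq_left) (use assms in simp)
    then show "degree (p - [:Z:]) = degree p" by (simp only: diff_conv_add_uminus)
    then show "lead_coeff (p - [:Z:]) = lead_coeff p"
      using assms by (simp add: coeff_eq_0)
  qed
  then obtain n where "\<And>x. x \<ge> n \<Longrightarrow> poly (p - [:Z:]) x \<ge> lead_coeff p"
    using poly_pinfty_gt_lc[of "p - [:Z:]"] assms by auto
  then have "\<And>x. x \<ge> n \<Longrightarrow> Z \<le> poly p x"
    using assms by fastforce
  then show "eventually (\<lambda>x. Z \<le> poly p x) at_top"
    by (auto simp: eventually_at_top_linorder)
qed

text \<open>The order on polynomials compares leading coefficients, hence growth at infinity, so the
  exponential of the largest exponent dominates.\<close>

lemma exp_poly_independent: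
  fixes F :: "real poly set"
  assumes "finite F" and "\<And>p. p \<in> F \<Longrightarrow> coeff p 0 = 0"
    and "\<And>t. (\<Sum>p\<in>F. c p * exp (poly p t)) = 0"
    and "p \<in> F"
  shows "c p = 0"
  using assms
proof (induction F arbitrary: p rule: finite_linorder_max_induct)
  case empty
  then show ?case by simp
next
  case (insert q F)
  have "q \<notin> F" using insert.hyps by auto
  have *: "((\<lambda>t. exp (poly p t - poly q t)) \<longlongrightarrow> 0) at_top" if "p \<in> F" for p
  proof -
    have "pos_poly (q - p)"
      using insert.hyps that by (auto simp: less_poly_def)
    \<comment> \<open>All constant coefficients vanish, so a difference of degree 0 would be zero
      and not positive.\<close>
    moreover have "degree (q - p) > 0"
    proof (rule ccontr)
      assume "\<not> degree (q - p) > 0"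
      then have "lead_coeff (q - p) = coeff q 0 - coeff p 0" by simp
      also have "\<dots> = 0" using insert.prems(1) that by simp
      finally show False using \<open>pos_poly (q - p)\<close> by (simp add: pos_poly_def)
    qed
    ultimately have "filterlim (poly (q - p)) at_top at_top"
      by (intro filterlim_poly_at_top) (auto simp: pos_poly_def)
    then have "filterlim (\<lambda>t. - poly (q - p) t) at_bot at_top"
      unfolding filterlim_uminus_at_bot minus_minus .
    then have "((\<lambda>t. exp (- poly (q - p) t)) \<longlongrightarrow> 0) at_top"
      using filterlim_compose[OF exp_at_bot] by blast
    then show ?thesis by simp
  qed
  \<comment> \<open>The relation divided by \<open>exp (poly q t)\<close>: everything except
    \<open>c q\<close> tends to 0.\<close>
  have "c q + (\<Sum>p\<in>F. c p * exp (poly p t - poly q t)) = 0" for t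
  proof -
    have "(c q + (\<Sum>p\<in>F. c p * exp (poly p t - poly q t))) * exp (poly q t)
        = (\<Sum>p\<in>insert q F. c p * exp (poly p t))"
      using \<open>q \<notin> F\<close> insert.hyps
      by (simp add: distrib_right sum_distrib_right mult.assoc exp_add[symmetric])
    then show ?thesis using insert.prems(2)[of t] by simp
  qed
  moreover have "((\<lambda>t. c q + (\<Sum>p\<in>F. c p * exp (poly p t - poly q t))) \<longlongrightarrow> c q + (\<Sum>p\<in>F. c p * 0)) at_top"
    by (intro tendsto_intros *)
  ultimately have "c q = 0"
    by (simp add: tendsto_const_iff)
  then have "(\<Sum>p\<in>F. c p * exp (poly p t)) = 0" for t
    using insert.prems(2)[of t] insert.hyps \<open>q \<notin> F\<close> by simp
  then show ?case
    using insert.IH[of p] insert.prems \<open>c q = 0\<close> by auto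
qed

text \<open>Exponents that agree up to a constant are collected into one term, the constants moving
  into the coefficients. By positivity nothing cancels within a side, so by independence the class
  of \<open>p i\<close> must also occur on the right. Constant coefficients stay unmatched because
  they can be traded against \<open>a\<close> and \<open>b\<close>.\<close>

lemma exp_poly_sum_eq_imp_match:
  fixes p q :: "_ \<Rightarrow> real poly"
  assumes fin: "finite I" "finite J"
    and pos: "\<And>i. i \<in> I \<Longrightarrow> a i > 0" "\<And>j. j \<in> J \<Longrightarrow> b j > 0"
    and eq: "\<And>t. (\<Sum>i\<in>I. a i * exp (poly (p i) t)) = (\<Sum>j\<in>J. b j * exp (poly (q j) t))"
    and "i \<in> I"
  obtains j where "j \<in> J" "\<And>n. n > 0 \<Longrightarrow> coeff (p i) n = coeff (q j) n"
proof -
  \<comment> \<open>\<open>r\<close> is the exponent without its constant coefficient, the normal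
    form that linear independence asks for; \<open>e\<close> is the factor split off.\<close>
  define r where "r p = p - [:coeff p 0:]" for p :: "real poly"
  define e where "e p = exp (coeff p 0)" for p :: "real poly"
  have exp_r: "exp (poly p t) = e p * exp (poly (r p) t)" for p t
    by (simp add: r_def e_def exp_add[symmetric])
  define c where "c s = (\<Sum>i\<in>{i\<in>I. r (p i) = s}. a i * e (p i))" for s
  define d where "d s = (\<Sum>j\<in>{j\<in>J. r (q j) = s}. b j * e (q j))" for s
  define F where "F = (\<lambda>i. r (p i)) ` I \<union> (\<lambda>j. r (q j)) ` J"
  have "finite F" using fin by (simp add: F_def)
  have "(\<Sum>s\<in>F. (c s - d s) * exp (poly s t)) = 0" for t
  proof -
    have "(\<Sum>i\<in>I. a i * exp (poly (p i) t)) = (\<Sum>s\<in>F. \<Sum>i\<in>{i\<in>I. r (p i) = s}. a i * exp (poly (p i) t))"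
      by (rule sum.group[symmetric]) (use fin \<open>finite F\<close> in \<open>auto simp: F_def\<close>)
    also have "\<dots> = (\<Sum>s\<in>F. c s * exp (poly s t))"
      unfolding c_def sum_distrib_right
      by (intro sum.cong refl) (auto simp: exp_r[of "p i" for i] mult.assoc)
    finally have 1: "(\<Sum>i\<in>I. a i * exp (poly (p i) t)) = (\<Sum>s\<in>F. c s * exp (poly s t))" .
    have "(\<Sum>j\<in>J. b j * exp (poly (q j) t)) = (\<Sum>s\<in>F. \<Sum>j\<in>{j\<in>J. r (q j) = s}. b j * exp (poly (q j) t))"
      by (rule sum.group[symmetric]) (use fin \<open>finite F\<close> in \<open>auto simp: F_def\<close>)
    also have "\<dots> = (\<Sum>s\<in>F. d s * exp (poly s t))"
      unfolding d_def sum_distrib_right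
      by (intro sum.cong refl) (auto simp: exp_r[of "q i" for i] mult.assoc)
    finally show ?thesis using 1 eq[of t] by (simp add: left_diff_distrib sum_subtractf)
  qed
  then have "c (r (p i)) - d (r (p i)) = 0"
    using \<open>finite F\<close> \<open>i \<in> I\<close>
    by (intro exp_poly_independent[of F "\<lambda>s. c s - d s"]) (auto simp: F_def r_def)
  moreover have "c (r (p i)) > 0"
    unfolding c_def using fin \<open>i \<in> I\<close> pos by (intro sum_pos) (auto simp: e_def)
  ultimately have "d (r (p i)) \<noteq> 0" by simp
  then obtain j where j: "j \<in> J" "r (q j) = r (p i)"
    unfolding d_def by (metis (mono_tags, lifting) mem_Collect_eq sum.neutral)
  have "coeff (p i) n = coeff (q j) n" if "n > 0" for n
    using arg_cong[OF j(2), of "\<lambda>p. coeff p n"] that by (auto simp: r_def coeff_pCons split: nat.splits)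
  then show thesis using that j by blast
qed

text \<open>Weights \<open>w\<^sub>i = N ^ f i\<close> work for every \<open>N\<close> that avoids the roots of finitely many polynomials.\<close>

lemma exists_separating_weights:
  fixes S :: "('d::finite \<Rightarrow> nat) set"
  assumes "finite S"
  shows "\<exists>w :: 'd \<Rightarrow> nat. inj_on (\<lambda>s. \<Sum>i\<in>UNIV. s i * w i) S"
proof -
  obtain f :: "'d \<Rightarrow> nat" where f: "inj f"
    using finite_imp_inj_to_nat_seg[of "UNIV :: 'd set"] by auto
  \<comment> \<open>The exponent vector is stored as the coefficients of a polynomial. Its value at
    \<open>N\<close> is the weighted degree for the weights \<open>N ^ f i\<close>.\<close>
  define p where "p s = (\<Sum>i\<in>UNIV. monom (real (s i)) (f i))" for s :: "'d \<Rightarrow> nat"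
  have coeff_p: "coeff (p s) (f i) = s i" for s i
    using f by (simp add: p_def coeff_sum inj_eq)
  have "inj p"
  proof (rule injI, rule ext)
    fix s s' i assume "p s = p s'"
    then show "s i = s' i" using coeff_p[of s i] coeff_p[of s' i] by simp
  qed
  define R where "R = (\<Union>(s, s')\<in>{(s, s')\<in>S \<times> S. s \<noteq> s'}. {x. poly (p s - p s') x = 0})"
  have "finite R" unfolding R_def
  proof (rule finite_UN_I)
    show "finite {(s, s')\<in>S \<times> S. s \<noteq> s'}"
      by (rule finite_subset[of _ "S \<times> S"]) (use assms in auto)
    fix z assume "z \<in> {(s, s')\<in>S \<times> S. s \<noteq> s'}"
    then obtain s s' where "z = (s, s')" "p s - p s' \<noteq> 0"
      using \<open>inj p\<close> by (auto simp: inj_eq)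
    then show "finite (case z of (s, s') \<Rightarrow> {x. poly (p s - p s') x = 0})"
      using poly_roots_finite[of "p s - p s'"] by simp
  qed
  then have "infinite (range real - R)"
    by (intro Diff_infinite_finite) (auto simp: finite_image_iff)
  then have "range real - R \<noteq> {}"
    by (rule infinite_imp_nonempty)
  then obtain N :: nat where N: "real N \<notin> R"
    by blast
  have poly_p: "poly (p s) (real N) = real (\<Sum>i\<in>UNIV. s i * N ^ f i)" for s
    by (simp add: p_def poly_sum poly_monom)
  have "inj_on (\<lambda>s. \<Sum>i\<in>UNIV. s i * N ^ f i) S"
  proof (intro inj_onI, rule ccontr)
    fix s s' assume "s \<in> S" "s' \<in> S" "s \<noteq> s'"
      and "(\<Sum>i\<in>UNIV. s i * N ^ f i) = (\<Sum>i\<in>UNIV. s' i * N ^ f i)"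
    then have "poly (p s - p s') (real N) = 0"
      using poly_p[of s] poly_p[of s'] by simp
    then have "real N \<in> R"
      unfolding R_def using \<open>s \<in> S\<close> \<open>s' \<in> S\<close> \<open>s \<noteq> s'\<close>
      by (intro UN_I[of "(s, s')"]) auto
    then show False using N by simp
  qed
  then show ?thesis by (rule exI[of _ "\<lambda>i. N ^ f i"])
qed

text \<open>The substitution \<open>x\<^sub>i = t ^ w\<^sub>i\<close> with separating weights maps distinct monomials to distinct
  powers of \<open>t\<close>.\<close>

lemma exp_monomial_sum_eq_imp_match:
  fixes S :: "(real^'d \<Rightarrow> real) set"
  assumes fin: "finite S" "finite I" "finite J"
    and mono: "\<And>b. b \<in> S \<Longrightarrow> monomial b"
    and pos: "\<And>i. i \<in> I \<Longrightarrow> a i > 0" "\<And>j. j \<in> J \<Longrightarrow> a' j > 0"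
    and eq: "\<And>x. (\<Sum>i\<in>I. a i * exp (\<Sum>b\<in>S. c i b * b x)) = (\<Sum>j\<in>J. a' j * exp (\<Sum>b\<in>S. c' j b * b x))"
    and "i \<in> I"
  obtains j where "j \<in> J" "\<And>b. b \<in> S \<Longrightarrow> b \<noteq> (\<lambda>x. 1) \<Longrightarrow> c i b = c' j b"
proof -
  obtain s :: "(real^'d \<Rightarrow> real) \<Rightarrow> 'd \<Rightarrow> nat"
    where s: "\<And>b. b \<in> S \<Longrightarrow> b = (\<lambda>x. \<Prod>i\<in>UNIV. (x $ i) ^ s b i)"
    using mono unfolding monomial_def by metis
  \<comment> \<open>The zero vector is included so that every nonconstant monomial receives a
    positive degree in \<open>t\<close>.\<close>
  obtain w :: "'d \<Rightarrow> nat" where w: "inj_on (\<lambda>s. \<Sum>i\<in>UNIV. s i * w i) (insert (\<lambda>_. 0) (s ` S))"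
    by (rule exE[OF exists_separating_weights[OF finite.insertI[OF finite_imageI[OF fin(1)]]]])
  define d where "d b = (\<Sum>i\<in>UNIV. s b i * w i)" for b
  have inj_d: "inj_on d S"
  proof (rule inj_onI)
    fix b b' assume bb: "b \<in> S" "b' \<in> S" "d b = d b'"
    then have "s b = s b'" using w by (auto simp: d_def inj_on_def)
    then show "b = b'" using s[OF bb(1)] s[OF bb(2)] by simp
  qed
  have d_pos: "d b > 0" if "b \<in> S" "b \<noteq> (\<lambda>x. 1)" for b
  proof (rule ccontr)
    assume "\<not> d b > 0"
    then have "s b = (\<lambda>_. 0)" using w that by (auto simp: d_def inj_on_def)
    then show False using s[OF that(1)] that(2) by simp
  qed
  define P where "P c = (\<Sum>b\<in>S. monom (c b) (d b))" for c :: "_ \<Rightarrow> real"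
  have coeff_P: "coeff (P c) (d b) = c b" if "b \<in> S" for b c
  proof -
    have "coeff (P c) (d b) = (\<Sum>b'\<in>S. if b' = b then c b' else 0)"
      unfolding P_def coeff_sum using inj_d that by (intro sum.cong) (auto simp: inj_on_def)
    then show ?thesis using that fin by simp
  qed
  have poly_P: "poly (P c) t = (\<Sum>b\<in>S. c b * b (\<chi> i. t ^ w i))" for c t
  proof -
    have "b (\<chi> i. t ^ w i) = t ^ d b" if "b \<in> S" for b
      by (subst s[OF that]) (simp add: d_def power_sum power_mult[symmetric] mult.commute)
    then show ?thesis by (simp add: P_def poly_sum poly_monom)
  qed
  obtain j where "j \<in> J" "\<And>n. n > 0 \<Longrightarrow> coeff (P (c i)) n = coeff (P (c' j)) n"
    by (rule exp_poly_sum_eq_imp_match[of I J a a' "\<lambda>i. P (c i)" "\<lambda>j. P (c' j)" i])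
       (use fin pos eq \<open>i \<in> I\<close> in \<open>auto simp: poly_P\<close>)
  then show thesis using that[of j] d_pos coeff_P by metis
qed

section \<open>Exponential tilting of normal mixtures\<close>

lemma one_div_eq_if_logit_eq:
  assumes "0 < p" "p < 1" "logit p = z"
  shows "1 / p = 1 + exp (- z)"
proof -
  have "exp z = p / (1 - p)"
    using assms by (auto simp: logit_def)
  then show ?thesis
    using assms by (simp add: exp_minus field_simps)
qed

text \<open>Completing the square: tilting shifts the mean by
  \<open>- \<beta> * \<sigma>\<^sup>2\<close>, and the factor split off is the moment generating
  function of the normal law at \<open>- \<beta>\<close>.\<close>

lemma normal_density_times_exp:
  assumes "\<sigma> > 0"
  shows "normal_density \<mu> \<sigma> u * exp (- \<beta> * u) =
    exp (- \<beta> * \<mu> + \<beta>\<^sup>2 * \<sigma>\<^sup>2 / 2) * normal_density (\<mu> - \<beta> * \<sigma>\<^sup>2) \<sigma> u"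
proof -
  have "- (u - \<mu>)\<^sup>2 / (2 * \<sigma>\<^sup>2) + - \<beta> * u
      = (- \<beta> * \<mu> + \<beta>\<^sup>2 * \<sigma>\<^sup>2 / 2) + - (u - (\<mu> - \<beta> * \<sigma>\<^sup>2))\<^sup>2 / (2 * \<sigma>\<^sup>2)"
    using assms by (simp add: field_simps power2_eq_square)
  then have "exp (- (u - \<mu>)\<^sup>2 / (2 * \<sigma>\<^sup>2)) * exp (- \<beta> * u)
      = exp (- \<beta> * \<mu> + \<beta>\<^sup>2 * \<sigma>\<^sup>2 / 2) * exp (- (u - (\<mu> - \<beta> * \<sigma>\<^sup>2))\<^sup>2 / (2 * \<sigma>\<^sup>2))"
    by (simp only: exp_add[symmetric])
  then show ?thesis by (simp add: normal_density_def mult.assoc)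
qed

text \<open>The two-sided Laplace transform at \<beta> of the respondents' density, in closed form,
  so that it is visibly a sum of exponentials of polynomials in \<open>x\<close>.\<close>

definition resp_laplace ::
  "(nat \<Rightarrow> nat \<Rightarrow> real^'d \<Rightarrow> real) \<Rightarrow> (nat \<Rightarrow> nat) \<Rightarrow> mixture_param \<Rightarrow> real \<Rightarrow> real^'d \<Rightarrow> real" where
  "resp_laplace \<eta> m \<gamma> \<beta> x =
     (\<Sum>k=1..ncomp \<gamma>. mixp \<gamma> k * exp (- \<beta> * comp_mean \<eta> m \<gamma> k x + \<beta>\<^sup>2 * sigma2 \<gamma> k / 2))"

text \<open>Each tilted component is a constant multiple of a normal density with shifted mean,
  which integrates to 1.\<close>

lemma has_bochner_integral_resp_laplace:
  assumes "\<gamma> \<in> mixture_param_space m"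
  shows "has_bochner_integral lborel (\<lambda>u. resp_density \<eta> m \<gamma> x u * exp (- \<beta> * u)) (resp_laplace \<eta> m \<gamma> \<beta> x)"
  unfolding resp_density_def resp_laplace_def sum_distrib_right
proof (rule has_bochner_integral_sum)
  fix k assume "k \<in> {1..ncomp \<gamma>}"
  then have pos: "sigma2 \<gamma> k > 0"
    using assms by (auto simp: mixture_param_space_def)
  define \<mu> where "\<mu> = comp_mean \<eta> m \<gamma> k x"
  have "has_bochner_integral lborel (normal_density (\<mu> - \<beta> * sigma2 \<gamma> k) (sqrt (sigma2 \<gamma> k))) 1"
    using pos by (simp add: has_bochner_integral_iff)
  then have "has_bochner_integral lborel
      (\<lambda>u. mixp \<gamma> k * exp (- \<beta> * \<mu> + \<beta>\<^sup>2 * sigma2 \<gamma> k / 2) *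
        normal_density (\<mu> - \<beta> * sigma2 \<gamma> k) (sqrt (sigma2 \<gamma> k)) u)
      (mixp \<gamma> k * exp (- \<beta> * \<mu> + \<beta>\<^sup>2 * sigma2 \<gamma> k / 2) * 1)"
    by (rule has_bochner_integral_mult_right)
  moreover have "mixp \<gamma> k * exp (- \<beta> * \<mu> + \<beta>\<^sup>2 * sigma2 \<gamma> k / 2) *
        normal_density (\<mu> - \<beta> * sigma2 \<gamma> k) (sqrt (sigma2 \<gamma> k)) u =
      mixp \<gamma> k * normal_density \<mu> (sqrt (sigma2 \<gamma> k)) u * exp (- \<beta> * u)" for u
    using normal_density_times_exp[of "sqrt (sigma2 \<gamma> k)" \<mu> u \<beta>] pos by simp
  ultimately show "has_bochner_integral lborel
      (\<lambda>u. mixp \<gamma> k * normal_density (comp_mean \<eta> m \<gamma> k x) (sqrt (sigma2 \<gamma> k)) u * exp (- \<beta> * u))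
      (mixp \<gamma> k * exp (- \<beta> * comp_mean \<eta> m \<gamma> k x + \<beta>\<^sup>2 * sigma2 \<gamma> k / 2))"
    unfolding \<mu>_def by (simp only: mult_1_right)
qed

lemma has_bochner_integral_resp_density:
  assumes "\<gamma> \<in> mixture_param_space m"
  shows "has_bochner_integral lborel (resp_density \<eta> m \<gamma> x) 1"
proof -
  \<comment> \<open>At \<beta> = 0 the transform is the sum of the mixing proportions.\<close>
  have "resp_laplace \<eta> m \<gamma> 0 x = 1"
    using assms by (simp add: resp_laplace_def mixture_param_space_def)
  then show ?thesis
    using has_bochner_integral_resp_laplace[OF assms, of \<eta> x 0] by simp
qed

lemma mixture_has_component:
  assumes "\<gamma> \<in> mixture_param_space m"
  shows "ncomp \<gamma> \<ge> 1"
  using assms by (cases "ncomp \<gamma>") (auto simp: mixture_param_space_def)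

lemma resp_laplace_nonneg:
  "\<gamma> \<in> mixture_param_space m \<Longrightarrow> resp_laplace \<eta> m \<gamma> \<beta> x \<ge> 0"
  unfolding resp_laplace_def by (intro sum_nonneg) (auto simp: mixture_param_space_def)

lemma resp_density_pos:
  assumes "\<gamma> \<in> mixture_param_space m" "\<And>k. k \<in> {1..ncomp \<gamma>} \<Longrightarrow> mixp \<gamma> k \<noteq> 0"
  shows "resp_density \<eta> m \<gamma> x y > 0"
  unfolding resp_density_def
proof (rule sum_pos)
  fix k assume k: "k \<in> {1..ncomp \<gamma>}"
  then have "mixp \<gamma> k > 0" "sigma2 \<gamma> k > 0"
    using assms(2)[OF k] assms(1) by (auto simp: mixture_param_space_def order_less_le)
  then show "0 < mixp \<gamma> k * normal_density (comp_mean \<eta> m \<gamma> k x) (sqrt (sigma2 \<gamma> k)) y"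
    by (simp add: normal_density_pos)
qed (use mixture_has_component[OF assms(1)] in auto)

lemma resp_laplace_pos:
  assumes "\<gamma> \<in> mixture_param_space m" "\<And>k. k \<in> {1..ncomp \<gamma>} \<Longrightarrow> mixp \<gamma> k \<noteq> 0"
  shows "resp_laplace \<eta> m \<gamma> \<beta> x > 0"
  unfolding resp_laplace_def
proof (rule sum_pos)
  fix k assume k: "k \<in> {1..ncomp \<gamma>}"
  then have "mixp \<gamma> k > 0"
    using assms(2)[OF k] assms(1) by (auto simp: mixture_param_space_def order_less_le)
  then show "0 < mixp \<gamma> k * exp (- \<beta> * comp_mean \<eta> m \<gamma> k x + \<beta>\<^sup>2 * sigma2 \<gamma> k / 2)"
    by simp
qed (use mixture_has_component[OF assms(1)] in auto)

section \<open>Measurability, analyticity and the Bayes normaliser\<close>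

lemma borel_measurable_monomial:
  assumes "monomial b"
  shows "b \<in> borel_measurable borel"
proof -
  obtain s where "b = (\<lambda>x. \<Prod>i\<in>UNIV. (x $ i) ^ s i)"
    using assms by (auto simp: monomial_def)
  then show ?thesis
    by (auto intro!: borel_measurable_continuous_onI continuous_intros)
qed

lemma real_entire_monomial:
  assumes "monomial b"
  shows "real_entire (\<lambda>t. b (x + t *\<^sub>R e))"
proof -
  obtain s where "b = (\<lambda>x. \<Prod>i\<in>UNIV. (x $ i) ^ s i)"
    using assms by (auto simp: monomial_def)
  then show ?thesis
    by (auto intro!: real_entire_prod real_entire_power real_entire_add real_entire_mult)
qed

text \<open>The normalisers depend on \<open>x\<close> alone and both densities have mass 1 in
  \<open>y\<close>. Integrating out \<open>y\<close> therefore isolates \<open>1 / C x\<close>, and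
  multiplying back gives equality of the densities.\<close>

lemma AE_eq_if_normalised_AE_eq:
  fixes g g' :: "'x \<Rightarrow> real \<Rightarrow> real"
  assumes "sigma_finite_measure D"
    and [measurable]: "C \<in> borel_measurable D" "C' \<in> borel_measurable D"
    and int: "\<And>x. has_bochner_integral lborel (g x) 1" "\<And>x. has_bochner_integral lborel (g' x) 1"
    and pos: "\<And>x. C' x > (0::real)"
    and eq: "AE (x, y) in D \<Otimes>\<^sub>M lborel. g x y / C x = g' x y / C' x"
  shows "AE x in D. C x = C' x" "AE (x, y) in D \<Otimes>\<^sub>M lborel. g x y = g' x y"
proof -
  interpret sigma_finite_measure D by fact
  interpret pair_sigma_finite D "lborel :: real measure" ..
  have "AE x in D. AE y in lborel. g x y / C x = g' x y / C' x"
    using AE_pair[OF eq] by simp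
  then show C: "AE x in D. C x = C' x"
  proof eventually_elim
    case (elim x)
    have "has_bochner_integral lborel (\<lambda>y. g x y / C x) (1 / C x)"
      by (intro has_bochner_integral_divide_zero int)
    moreover have "has_bochner_integral lborel (\<lambda>y. g' x y / C' x) (1 / C' x)"
      by (intro has_bochner_integral_divide_zero int)
    ultimately have "(LINT y|lborel. g x y / C x) = 1 / C x" "(LINT y|lborel. g' x y / C' x) = 1 / C' x"
      "integrable lborel (\<lambda>y. g x y / C x)" "integrable lborel (\<lambda>y. g' x y / C' x)"
      by (auto simp: has_bochner_integral_iff)
    moreover have "(LINT y|lborel. g x y / C x) = (LINT y|lborel. g' x y / C' x)"
      by (rule integral_cong_AE) (use elim calculation in auto)
    ultimately have "1 / C x = 1 / C' x" by metis
    \<comment> \<open>Inversion is injective on all reals, given \<open>1 / 0 = 0\<close>.\<close>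
    then show ?case by simp
  qed
  have "AE z in D \<Otimes>\<^sub>M (lborel :: real measure). C (fst z) = C' (fst z)"
  proof (rule AE_pair_measure)
    show "{z \<in> space (D \<Otimes>\<^sub>M (lborel :: real measure)). C (fst z) = C' (fst z)} \<in> sets (D \<Otimes>\<^sub>M lborel)"
      by measurable
    show "AE x in D. AE y in lborel. C (fst (x, y)) = C' (fst (x, y))"
      using C by eventually_elim simp
  qed
  with eq show "AE (x, y) in D \<Otimes>\<^sub>M lborel. g x y = g' x y"
  proof eventually_elim
    case (elim z)
    then show ?case using pos[of "fst z"] by (auto simp: case_prod_beta)
  qed
qed

text \<open>If \<open>F\<close> were nonzero at one point, its zero set would be Lebesgue null,
  hence null for \<open>D\<close> by absolute continuity, yet it carries the whole mass 1.\<close>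

lemma zero_if_AE_zero_continuous_distribution:
  fixes D :: "'a::euclidean_space measure"
  assumes "prob_space D" "continuous_distribution D"
    and "F \<in> borel_measurable borel" "\<And>x b. b \<in> Basis \<Longrightarrow> real_entire (\<lambda>t. F (x + t *\<^sub>R b))"
    and "AE x in D. F x = 0"
  shows "F x0 = 0"
proof (rule ccontr)
  assume "F x0 \<noteq> 0"
  then have nz: "AE x in lborel. F x \<noteq> 0"
    using assms by (intro AE_nonzero_if_entire_on_lines)
  obtain p where p: "p \<in> borel_measurable lborel" "D = density lborel p"
    using assms by (auto simp: continuous_distribution_def)
  have "AE x in D. F x \<noteq> 0"
    unfolding p(2) AE_density[OF p(1)] using nz by eventually_elim simp
  with assms(5) have "AE x in D. False"
    by eventually_elim simp
  then show False
    using prob_space.AE_False[OF assms(1)] by simp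
qed

lemma borel_measurable_lin_pred:
  assumes "\<And>j. monomial (h j)"
  shows "lin_pred h \<alpha> \<in> borel_measurable borel"
  unfolding lin_pred_def using borel_measurable_monomial[OF assms] by measurable

lemma borel_measurable_comp_mean:
  assumes "\<And>l. l \<le> m k \<Longrightarrow> monomial (\<eta> l k)"
  shows "comp_mean \<eta> m \<gamma> k \<in> borel_measurable borel"
  unfolding comp_mean_def
  by (intro borel_measurable_sum borel_measurable_times borel_measurable_const borel_measurable_monomial assms) auto

lemma borel_measurable_resp_laplace:
  assumes "\<And>k l. k \<ge> 1 \<Longrightarrow> l \<le> m k \<Longrightarrow> monomial (\<eta> l k)"
  shows "resp_laplace \<eta> m \<gamma> \<beta> \<in> borel_measurable borel"
  unfolding resp_laplace_def
proof (rule borel_measurable_sum)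
  fix k assume "k \<in> {1..ncomp \<gamma>}"
  then have [measurable]: "comp_mean \<eta> m \<gamma> k \<in> borel_measurable borel"
    by (intro borel_measurable_comp_mean assms) auto
  show "(\<lambda>x. mixp \<gamma> k * exp (- \<beta> * comp_mean \<eta> m \<gamma> k x + \<beta>\<^sup>2 * sigma2 \<gamma> k / 2)) \<in> borel_measurable borel"
    by measurable
qed

lemma borel_measurable_resp_density:
  assumes "\<And>k l. k \<ge> 1 \<Longrightarrow> l \<le> m k \<Longrightarrow> monomial (\<eta> l k)"
  shows "(\<lambda>(x, y). resp_density \<eta> m \<gamma> x y) \<in> borel_measurable (borel \<Otimes>\<^sub>M borel)"
  unfolding resp_density_def case_prod_beta
proof (rule borel_measurable_sum)
  fix k assume "k \<in> {1..ncomp \<gamma>}"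
  then have [measurable]: "comp_mean \<eta> m \<gamma> k \<in> borel_measurable borel"
    by (intro borel_measurable_comp_mean assms) auto
  show "(\<lambda>z. mixp \<gamma> k * normal_density (comp_mean \<eta> m \<gamma> k (fst z)) (sqrt (sigma2 \<gamma> k)) (snd z))
      \<in> borel_measurable (borel \<Otimes>\<^sub>M borel)"
    unfolding normal_density_def by measurable
qed

lemma real_entire_lin_pred:
  assumes "\<And>j. monomial (h j)"
  shows "real_entire (\<lambda>t. lin_pred h \<alpha> (x + t *\<^sub>R e))"
  unfolding lin_pred_def
  by (intro real_entire_sum real_entire_mult real_entire_const real_entire_monomial assms)

lemma real_entire_resp_laplace:
  assumes "\<And>k l. k \<ge> 1 \<Longrightarrow> l \<le> m k \<Longrightarrow> monomial (\<eta> l k)"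
  shows "real_entire (\<lambda>t. resp_laplace \<eta> m \<gamma> \<beta> (x + t *\<^sub>R e))"
  unfolding resp_laplace_def comp_mean_def
  by (intro real_entire_sum real_entire_mult real_entire_exp real_entire_add real_entire_const
      real_entire_monomial assms) auto

text \<open>Since \<open>1 / P x y = 1 + exp (- z) * exp (- \<beta> * y)\<close>, the normalising
  integral splits into the mass of \<open>g x\<close> and a multiple of its Laplace transform. The
  first formula serves measurability and positivity, the second is the quantity compared in the
  definition of identifiability.\<close>

lemma cond_density_logistic:
  fixes P :: "'x \<Rightarrow> real \<Rightarrow> real"
  assumes P: "\<And>y. 0 < P x y \<and> P x y < 1 \<and> logit (P x y) = z + \<beta> * y"
    and g: "has_bochner_integral lborel (g x) 1"
    and L: "has_bochner_integral lborel (\<lambda>u. g x u * exp (- \<beta> * u)) L"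
  shows "cond_density P g x y = g x y * (1 + exp (- (z + \<beta> * y))) / (1 + exp (- z) * L)"
    and "P x y * cond_density P g x y = g x y / (1 + exp (- z) * L)"
proof -
  have inv: "1 / P x y = 1 + exp (- (z + \<beta> * y))" for y
    using P by (intro one_div_eq_if_logit_eq) auto
  have gP: "g x y / P x y = g x y * (1 + exp (- (z + \<beta> * y)))" for y
    using inv[of y] by (metis times_divide_eq_right mult.right_neutral)
  have "has_bochner_integral lborel (\<lambda>u. g x u + exp (- z) * (g x u * exp (- \<beta> * u))) (1 + exp (- z) * L)"
    by (intro has_bochner_integral_add has_bochner_integral_mult_right g L)
  moreover have "g x u + exp (- z) * (g x u * exp (- \<beta> * u)) = g x u / P x u" for u
    unfolding gP by (simp add: algebra_simps exp_add[symmetric])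
  ultimately have I: "(LINT u|lborel. g x u / P x u) = 1 + exp (- z) * L"
    by (simp add: has_bochner_integral_iff)
  show "cond_density P g x y = g x y * (1 + exp (- (z + \<beta> * y))) / (1 + exp (- z) * L)"
    unfolding cond_density_def I by (simp only: gP)
  show "P x y * cond_density P g x y = g x y / (1 + exp (- z) * L)"
    unfolding cond_density_def I using P[of y] by simp
qed

section \<open>Matching of exponents and determination of \<beta>\<close>

text \<open>Both sides are positive combinations of exponentials of polynomials, so each exponent on
  the left has a partner on the right with the same nonconstant coefficients. At a monomial of
  \<open>basis_M\<close> the predictor \<open>lin_pred h\<close> contributes nothing, and only
  \<beta> times the coefficient of the mean remains.\<close>

lemma comp_mean_M_match:
  fixes h :: "'j::finite \<Rightarrow> real^'d \<Rightarrow> real"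
  assumes h: "\<And>j. monomial (h j)"
    and eta: "\<And>k l. k \<ge> 1 \<Longrightarrow> l \<le> m k \<Longrightarrow> monomial (\<eta> l k)"
    and \<gamma>: "\<gamma> \<in> mixture_param_space m" "\<And>k. k \<in> {1..ncomp \<gamma>} \<Longrightarrow> mixp \<gamma> k \<noteq> 0"
    and eq: "\<And>x. exp (- lin_pred h \<alpha> x) * resp_laplace \<eta> m \<gamma> \<beta> x
               = exp (- lin_pred h \<alpha>' x) * resp_laplace \<eta> m \<gamma> \<beta>' x"
    and k: "k \<in> {1..ncomp \<gamma>}"
  shows "\<exists>k'\<in>{1..ncomp \<gamma>}. \<forall>x. \<beta> * comp_mean_M h \<eta> m \<gamma> k x = \<beta>' * comp_mean_M h \<eta> m \<gamma> k' x"
proof -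
  define M where "M = basis_M h \<eta> m (ncomp \<gamma>)"
  define E where "E = (\<Union>k\<in>{1..ncomp \<gamma>}. (\<lambda>l. \<eta> l k) ` {0..m k})"
  define S where "S = E \<union> basis_H h"
  have M_eq: "M = E - basis_H h"
    unfolding M_def E_def basis_M_def by blast
  have fin: "finite E" "finite S"
    by (simp_all add: E_def S_def basis_H_def)
  have mono: "monomial b" if "b \<in> S" for b
  proof -
    have "monomial (\<lambda>x::real^'d. 1)"
      unfolding monomial_def by (rule exI[of _ "\<lambda>_. 0"]) simp
    then show ?thesis using that h eta by (auto simp: S_def E_def basis_H_def)
  qed
  \<comment> \<open>Different indices may carry the same monomial, so coefficients are summed per
    monomial; likewise in \<open>v\<close>.\<close>
  define u where "u k b = (\<Sum>l\<in>{l\<in>{0..m k}. \<eta> l k = b}. kappa \<gamma> l k)" for k b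
  define v where "v \<alpha> b = (\<Sum>j\<in>{j. h j = b}. \<alpha> $ j)" for \<alpha> :: "real^'j" and b
  have mean: "comp_mean \<eta> m \<gamma> k x = (\<Sum>b\<in>S. u k b * b x)" if "k \<in> {1..ncomp \<gamma>}" for k x
  proof -
    have "comp_mean \<eta> m \<gamma> k x = (\<Sum>b\<in>S. \<Sum>l\<in>{l\<in>{0..m k}. \<eta> l k = b}. \<eta> l k x * kappa \<gamma> l k)"
      unfolding comp_mean_def
      by (rule sum.group[symmetric]) (use fin that in \<open>auto simp: S_def E_def\<close>)
    also have "\<dots> = (\<Sum>b\<in>S. u k b * b x)"
      unfolding u_def sum_distrib_right by (intro sum.cong refl) (auto simp: mult.commute)
    finally show ?thesis .
  qed
  have pred: "lin_pred h \<alpha> x = (\<Sum>b\<in>S. v \<alpha> b * b x)" for \<alpha> x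
  proof -
    have "lin_pred h \<alpha> x = (\<Sum>b\<in>S. \<Sum>j\<in>{j\<in>UNIV. h j = b}. \<alpha> $ j * h j x)"
      unfolding lin_pred_def
      by (rule sum.group[symmetric]) (use fin in \<open>auto simp: S_def basis_H_def\<close>)
    then show ?thesis
      by (auto simp: v_def sum_distrib_right intro!: sum.cong)
  qed
  have mean_M: "comp_mean_M h \<eta> m \<gamma> k x = (\<Sum>b\<in>M. u k b * b x)" for k x
  proof -
    have "comp_mean_M h \<eta> m \<gamma> k x =
        (\<Sum>b\<in>M. \<Sum>l\<in>{l\<in>{l\<in>{0..m k}. \<eta> l k \<in> M}. \<eta> l k = b}. \<eta> l k x * kappa \<gamma> l k)"
      unfolding comp_mean_M_def M_def[symmetric]
      by (rule sum.group[symmetric]) (use fin in \<open>auto simp: M_eq\<close>)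
    also have "\<dots> = (\<Sum>b\<in>M. \<Sum>l\<in>{l\<in>{0..m k}. \<eta> l k = b}. \<eta> l k x * kappa \<gamma> l k)"
      by (intro sum.cong) auto
    also have "\<dots> = (\<Sum>b\<in>M. u k b * b x)"
      unfolding u_def sum_distrib_right by (intro sum.cong refl) (auto simp: mult.commute)
    finally show ?thesis .
  qed
  \<comment> \<open>The variance enters only through this factor, free of \<open>x\<close>. It may
    differ between \<beta> and \<beta>', since the matching uses only its positivity.\<close>
  define a where "a \<beta> k = mixp \<gamma> k * exp (\<beta>\<^sup>2 * sigma2 \<gamma> k / 2)" for \<beta> k
  define c where "c \<alpha> \<beta> k b = - \<beta> * u k b - v \<alpha> b" for \<alpha> \<beta> k b
  have expand: "exp (- lin_pred h \<alpha> x) * resp_laplace \<eta> m \<gamma> \<beta> x =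
      (\<Sum>k=1..ncomp \<gamma>. a \<beta> k * exp (\<Sum>b\<in>S. c \<alpha> \<beta> k b * b x))" for \<alpha> \<beta> x
  proof -
    have c_sum: "(\<Sum>b\<in>S. c \<alpha> \<beta> k b * b x) = - \<beta> * comp_mean \<eta> m \<gamma> k x - lin_pred h \<alpha> x"
      if "k \<in> {1..ncomp \<gamma>}" for k
      unfolding mean[OF that] pred c_def
      by (simp add: left_diff_distrib sum_subtractf sum_negf sum_distrib_left mult.assoc)
    show ?thesis
      unfolding resp_laplace_def sum_distrib_left
    proof (intro sum.cong refl)
      fix k assume "k \<in> {1..ncomp \<gamma>}"
      have "exp (- lin_pred h \<alpha> x) * exp (- \<beta> * comp_mean \<eta> m \<gamma> k x + \<beta>\<^sup>2 * sigma2 \<gamma> k / 2) =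
          exp (\<beta>\<^sup>2 * sigma2 \<gamma> k / 2) * exp (\<Sum>b\<in>S. c \<alpha> \<beta> k b * b x)"
        unfolding c_sum[OF \<open>k \<in> {1..ncomp \<gamma>}\<close>] exp_add[symmetric] by (simp add: algebra_simps)
      then show "exp (- lin_pred h \<alpha> x) *
          (mixp \<gamma> k * exp (- \<beta> * comp_mean \<eta> m \<gamma> k x + \<beta>\<^sup>2 * sigma2 \<gamma> k / 2)) =
          a \<beta> k * exp (\<Sum>b\<in>S. c \<alpha> \<beta> k b * b x)"
        unfolding a_def by (simp only: mult.assoc mult.left_commute[of _ "mixp \<gamma> k"])
    qed
  qed
  have a_pos: "a \<beta> k > 0" if "k \<in> {1..ncomp \<gamma>}" for k \<beta>
    using \<gamma>(1) \<gamma>(2)[OF that] that by (auto simp: a_def mixture_param_space_def order_less_le)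
  obtain k' where k': "k' \<in> {1..ncomp \<gamma>}"
      "\<And>b. b \<in> S \<Longrightarrow> b \<noteq> (\<lambda>x. 1) \<Longrightarrow> c \<alpha> \<beta> k b = c \<alpha>' \<beta>' k' b"
    by (rule exp_monomial_sum_eq_imp_match[of S "{1..ncomp \<gamma>}" "{1..ncomp \<gamma>}" "a \<beta>" "a \<beta>'"
          "c \<alpha> \<beta>" "c \<alpha>' \<beta>'" k])
       (use fin mono a_pos eq k in \<open>auto simp: expand\<close>)
  have "\<beta> * u k b = \<beta>' * u k' b" if "b \<in> M" for b
  proof -
    have "v \<alpha> b = 0" for \<alpha>
    proof -
      have none: "{j. h j = b} = {}" using that by (auto simp: M_eq basis_H_def)
      show ?thesis unfolding v_def none by simp
    qed
    then show ?thesis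
      using k'(2)[of b] that by (auto simp: c_def M_eq S_def basis_H_def)
  qed
  then have "\<beta> * comp_mean_M h \<eta> m \<gamma> k x = \<beta>' * comp_mean_M h \<eta> m \<gamma> k' x" for x
    unfolding mean_M sum_distrib_left by (intro sum.cong) (simp_all add: mult.assoc[symmetric])
  then show ?thesis using k'(1) by blast
qed

text \<open>At the fixed point \<open>x\<close>, take an index with maximal
  \<open>\<bar>q i x\<bar>\<close>: its partner cannot exceed the maximum \<open>U\<close>, and
  \<open>U\<close> is positive. The choice of partners need not be injective.\<close>

lemma abs_le_if_scaled_match:
  fixes q :: "'i \<Rightarrow> 'x \<Rightarrow> real"
  assumes "finite I" "i0 \<in> I" "q i0 x \<noteq> 0"
    and match: "\<And>i. i \<in> I \<Longrightarrow> \<exists>i'\<in>I. \<forall>x. \<beta> * q i x = \<beta>' * q i' x"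
  shows "\<bar>\<beta>\<bar> \<le> \<bar>\<beta>'\<bar>"
proof -
  define U where "U = Max ((\<lambda>i. \<bar>q i x\<bar>) ` I)"
  have U_ge: "\<bar>q i x\<bar> \<le> U" if "i \<in> I" for i
    using assms(1) that by (simp add: U_def)
  have "U \<in> (\<lambda>i. \<bar>q i x\<bar>) ` I"
    unfolding U_def using assms by (intro Max_in) auto
  then obtain i where i: "i \<in> I" "U = \<bar>q i x\<bar>" by blast
  obtain i' where i': "i' \<in> I" "\<beta> * q i x = \<beta>' * q i' x"
    using match[OF i(1)] by blast
  have "\<bar>\<beta>\<bar> * U = \<bar>\<beta>'\<bar> * \<bar>q i' x\<bar>"
    using i'(2) by (simp add: i(2) abs_mult[symmetric])
  also have "\<dots> \<le> \<bar>\<beta>'\<bar> * U"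
    using U_ge[OF i'(1)] by (intro mult_left_mono) auto
  finally have "\<bar>\<beta>\<bar> * U \<le> \<bar>\<beta>'\<bar> * U" .
  moreover have "U > 0" using U_ge[OF assms(2)] assms(3) by auto
  ultimately show ?thesis by simp
qed

text \<open>Matching in both directions gives equal absolute values. If \<beta>' = - \<beta> were
  nonzero, the signs would be opposite and every \<open>q i\<close> would be the negative of a
  member of the family, making the family symmetric; \<open>sign\<close> rules this out.\<close>

lemma eq_if_scaled_match:
  fixes q :: "'i \<Rightarrow> 'x \<Rightarrow> real"
  assumes "finite I" "i0 \<in> I" "q i0 \<noteq> (\<lambda>x. 0)"
    and match: "\<And>i. i \<in> I \<Longrightarrow> \<exists>i'\<in>I. \<forall>x. \<beta> * q i x = \<beta>' * q i' x"
    and match': "\<And>i. i \<in> I \<Longrightarrow> \<exists>i'\<in>I. \<forall>x. \<beta>' * q i x = \<beta> * q i' x"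
    and sign: "0 \<le> \<beta> \<and> 0 \<le> \<beta>' \<or> \<beta> \<le> 0 \<and> \<beta>' \<le> 0 \<or> {q i | i. i \<in> I} \<noteq> {(\<lambda>x. - q i x) | i. i \<in> I}"
  shows "\<beta> = \<beta>'"
proof (rule ccontr)
  assume ne: "\<beta> \<noteq> \<beta>'"
  obtain x where x: "q i0 x \<noteq> 0" using assms(3) by auto
  have "\<bar>\<beta>\<bar> = \<bar>\<beta>'\<bar>"
    using abs_le_if_scaled_match[OF assms(1,2) x match] abs_le_if_scaled_match[OF assms(1,2) x match']
    by (rule antisym)
  with ne have \<beta>': "\<beta>' = - \<beta>" "\<beta> \<noteq> 0" by (auto simp: abs_if split: if_splits)
  have neg: "\<exists>i'\<in>I. q i = (\<lambda>x. - q i' x)" if i: "i \<in> I" for i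
  proof -
    obtain i' where "i' \<in> I" "\<forall>x. \<beta> * q i x = \<beta>' * q i' x"
      using match[OF i] by blast
    then have "q i x = - q i' x" for x
      using \<beta>'(2) unfolding \<beta>'(1) by (metis minus_mult_commute mult_left_cancel)
    then show ?thesis using \<open>i' \<in> I\<close> by blast
  qed
  have "{q i | i. i \<in> I} = {(\<lambda>x. - q i x) | i. i \<in> I}"
  proof (intro equalityI subsetI)
    fix f assume "f \<in> {q i | i. i \<in> I}"
    then show "f \<in> {(\<lambda>x. - q i x) | i. i \<in> I}" using neg by blast
  next
    fix f assume "f \<in> {(\<lambda>x. - q i x) | i. i \<in> I}"
    then obtain i where i: "i \<in> I" "f = (\<lambda>x. - q i x)" by blast
    then obtain i' where "i' \<in> I" "q i = (\<lambda>x. - q i' x)" using neg by blast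
    then show "f \<in> {q i | i. i \<in> I}" using i by auto
  qed
  then show False using sign \<beta>' by auto
qed

section \<open>Identifiability of the model\<close>

text \<open>A component of proportion 0 leaves no trace in the density although its mean enters the
  sets of (C4); \<open>components_present\<close> excludes it. With \<open>M_terms_present\<close>,
  a nonempty \<open>basis_M\<close> has a term that really occurs in some mean; if all its
  coefficients vanished, \<beta> could be confounded with \<open>lin_pred h\<close>. The sign in
  (C3) is weak, so \<beta> = 0 is compatible with either sign.\<close>

theorem theorem3:
  fixes D :: "(real^'d) measure"
    and h :: "'j::finite \<Rightarrow> real^'d \<Rightarrow> real"
    and \<eta> :: "nat \<Rightarrow> nat \<Rightarrow> real^'d \<Rightarrow> real"
    and m :: "nat \<Rightarrow> nat"
    and P :: "real^'j \<Rightarrow> real \<Rightarrow> real^'d \<Rightarrow> real \<Rightarrow> real"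
    and A :: "(real^'j) set" and B :: "real set" and \<Gamma> :: "mixture_param set"
  assumes x_law: "prob_space D" "sets D = sets borel"
    and h_monomial: "\<And>j. monomial (h j)"
    and eta_monomial: "\<And>l k. k \<ge> 1 \<Longrightarrow> l \<le> m k \<Longrightarrow> monomial (\<eta> l k)"
    and h_injective: "inj_on (lin_pred h) A"
    and mechanism: "\<And>\<alpha> \<beta> x y. \<alpha> \<in> A \<Longrightarrow> \<beta> \<in> B \<Longrightarrow>
          0 < P \<alpha> \<beta> x y \<and> P \<alpha> \<beta> x y < 1 \<and> logit (P \<alpha> \<beta> x y) = lin_pred h \<alpha> x + \<beta> * y"
    and params: "\<Gamma> \<subseteq> mixture_param_space m"
    and resp_ident: "resp_identifiable D (resp_density \<eta> m) \<Gamma>"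
    and components_present: "\<And>\<gamma> k. \<gamma> \<in> \<Gamma> \<Longrightarrow> k \<in> {1..ncomp \<gamma>} \<Longrightarrow> mixp \<gamma> k \<noteq> 0"
    and M_terms_present: "\<And>\<gamma>. \<gamma> \<in> \<Gamma> \<Longrightarrow> basis_M h \<eta> m (ncomp \<gamma>) \<noteq> {} \<Longrightarrow>
          \<exists>k\<in>{1..ncomp \<gamma>}. comp_mean_M h \<eta> m \<gamma> k \<noteq> (\<lambda>x. 0)"
    and C1: "continuous_distribution D"
    and C2: "\<And>\<gamma>. \<gamma> \<in> \<Gamma> \<Longrightarrow> basis_M h \<eta> m (ncomp \<gamma>) \<noteq> {}"
    and C3_or_C4:
      "((\<forall>\<beta>\<in>B. 0 \<le> \<beta>) \<or> (\<forall>\<beta>\<in>B. \<beta> \<le> 0)) \<or>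
       (\<forall>\<gamma>\<in>\<Gamma>. {comp_mean_M h \<eta> m \<gamma> i | i. i \<in> {1..ncomp \<gamma>}} \<noteq>
                {(\<lambda>x. - comp_mean_M h \<eta> m \<gamma> i x) | i. i \<in> {1..ncomp \<gamma>}})"
  shows "model_identifiable D P (resp_density \<eta> m) A B \<Gamma>"
  unfolding model_identifiable_def
proof (intro ballI impI)
  fix \<alpha> \<beta> \<gamma> \<alpha>' \<beta>' \<gamma>'
  assume in_space: "\<alpha> \<in> A" "\<beta> \<in> B" "\<gamma> \<in> \<Gamma>" "\<alpha>' \<in> A" "\<beta>' \<in> B" "\<gamma>' \<in> \<Gamma>"
    and eq: "AE (x, y) in joint_law D (cond_density (P \<alpha> \<beta>) (resp_density \<eta> m \<gamma>)).
            P \<alpha> \<beta> x y * cond_density (P \<alpha> \<beta>) (resp_density \<eta> m \<gamma>) x y =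
            P \<alpha>' \<beta>' x y * cond_density (P \<alpha>' \<beta>') (resp_density \<eta> m \<gamma>') x y"
  interpret prob_space D by fact
  define C where "C \<alpha> \<beta> \<gamma> x = 1 + exp (- lin_pred h \<alpha> x) * resp_laplace \<eta> m \<gamma> \<beta> x" for \<alpha> \<beta> \<gamma> x
  have \<gamma>_space: "\<gamma> \<in> mixture_param_space m" if "\<gamma> \<in> \<Gamma>" for \<gamma>
    using params that by blast
  have C_pos: "C \<alpha> \<beta> \<gamma> x > 0" if "\<gamma> \<in> \<Gamma>" for \<alpha> \<beta> \<gamma> x
    unfolding C_def using resp_laplace_nonneg[OF \<gamma>_space[OF that]]
    by (intro add_pos_nonneg mult_nonneg_nonneg) auto
  have [measurable]: "lin_pred h \<alpha> \<in> borel_measurable borel"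
    "resp_laplace \<eta> m \<gamma> \<beta> \<in> borel_measurable borel"
    "(\<lambda>(x, y). resp_density \<eta> m \<gamma> x y) \<in> borel_measurable (borel \<Otimes>\<^sub>M borel)" for \<alpha> \<beta> \<gamma>
    using h_monomial eta_monomial
    by (auto intro!: borel_measurable_lin_pred borel_measurable_resp_laplace borel_measurable_resp_density)
  have D_borel: "measurable D borel = measurable borel borel"
    using x_law(2) by (intro measurable_cong_sets) auto
  have D_pair: "measurable (D \<Otimes>\<^sub>M lborel) (borel :: real measure) = measurable (borel \<Otimes>\<^sub>M borel) borel"
    using x_law(2) by (intro measurable_cong_sets sets_pair_measure_cong) auto
  have C_meas: "C \<alpha> \<beta> \<gamma> \<in> borel_measurable D" for \<alpha> \<beta> \<gamma>
    unfolding C_def D_borel by measurable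
  have f_eq: "cond_density (P \<alpha> \<beta>) (resp_density \<eta> m \<gamma>) x y =
        resp_density \<eta> m \<gamma> x y * (1 + exp (- (lin_pred h \<alpha> x + \<beta> * y))) / C \<alpha> \<beta> \<gamma> x"
    and Pf_eq: "P \<alpha> \<beta> x y * cond_density (P \<alpha> \<beta>) (resp_density \<eta> m \<gamma>) x y =
        resp_density \<eta> m \<gamma> x y / C \<alpha> \<beta> \<gamma> x"
    if "\<alpha> \<in> A" "\<beta> \<in> B" "\<gamma> \<in> \<Gamma>" for \<alpha> \<beta> \<gamma> x y
    unfolding C_def
    by (rule cond_density_logistic[where P = "P \<alpha> \<beta>" and x = x and g = "resp_density \<eta> m \<gamma>",
          OF mechanism[OF that(1,2)]
          has_bochner_integral_resp_density[OF \<gamma>_space[OF that(3)]]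
          has_bochner_integral_resp_laplace[OF \<gamma>_space[OF that(3)]]])+
  have g_pos: "resp_density \<eta> m \<gamma> x y > 0" if "\<gamma> \<in> \<Gamma>" for \<gamma> x y
    using resp_density_pos[OF \<gamma>_space components_present] that by blast
  let ?f = "\<lambda>(x, y). ennreal (cond_density (P \<alpha> \<beta>) (resp_density \<eta> m \<gamma>) x y)"
  have "?f \<in> borel_measurable (D \<Otimes>\<^sub>M lborel)"
  proof -
    have "(\<lambda>z. cond_density (P \<alpha> \<beta>) (resp_density \<eta> m \<gamma>) (fst z) (snd z))
        \<in> borel_measurable (borel \<Otimes>\<^sub>M borel)"
      unfolding f_eq[OF in_space(1-3)] C_def by measurable
    then show ?thesis
      unfolding D_pair[symmetric] case_prod_beta by measurable
  qed
  \<comment> \<open>The joint law has an everywhere positive density, so its null sets are those of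
    the product of \<open>D\<close> and Lebesgue measure.\<close>
  then have "AE z in D \<Otimes>\<^sub>M lborel. 0 < ?f z \<longrightarrow> (case z of (x, y) \<Rightarrow>
            P \<alpha> \<beta> x y * cond_density (P \<alpha> \<beta>) (resp_density \<eta> m \<gamma>) x y =
            P \<alpha>' \<beta>' x y * cond_density (P \<alpha>' \<beta>') (resp_density \<eta> m \<gamma>') x y)"
    using eq unfolding joint_law_def by (subst (asm) AE_density)
  moreover have "0 < ?f z" for z
    using g_pos[OF in_space(3)] C_pos[OF in_space(3)] in_space
    by (auto simp: f_eq case_prod_beta intro!: divide_pos_pos mult_pos_pos add_pos_pos)
  ultimately have "AE (x, y) in D \<Otimes>\<^sub>M lborel.
      resp_density \<eta> m \<gamma> x y / C \<alpha> \<beta> \<gamma> x = resp_density \<eta> m \<gamma>' x y / C \<alpha>' \<beta>' \<gamma>' x"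
    using in_space by (simp add: Pf_eq)
  note AE_eq_if_normalised_AE_eq[OF sigma_finite_measure_axioms C_meas C_meas
      has_bochner_integral_resp_density[OF \<gamma>_space[OF in_space(3)]]
      has_bochner_integral_resp_density[OF \<gamma>_space[OF in_space(6)]]
      C_pos[OF in_space(6)] this]
  \<comment> \<open>Equality of the respondents' densities is turned into equality of their
    parameters by \<open>resp_ident\<close>.\<close>
  then have C_eq: "AE x in D. C \<alpha> \<beta> \<gamma> x = C \<alpha>' \<beta>' \<gamma>' x" and "\<gamma> = \<gamma>'"
    using resp_ident in_space by (auto simp: resp_identifiable_def)
  have L_eq: "exp (- lin_pred h \<alpha> x) * resp_laplace \<eta> m \<gamma> \<beta> x
            = exp (- lin_pred h \<alpha>' x) * resp_laplace \<eta> m \<gamma> \<beta>' x" for x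
  proof -
    \<comment> \<open>Differences and negations are written with \<open>- 1 *\<close> so that the
      closure rules for \<open>real_entire\<close> apply syntactically.\<close>
    let ?F = "\<lambda>x. exp (- 1 * lin_pred h \<alpha> x) * resp_laplace \<eta> m \<gamma> \<beta> x
            + - 1 * (exp (- 1 * lin_pred h \<alpha>' x) * resp_laplace \<eta> m \<gamma> \<beta>' x)"
    have "?F x = 0"
    proof (rule zero_if_AE_zero_continuous_distribution[OF x_law(1) C1, where F = ?F])
      show "?F \<in> borel_measurable borel" by measurable
      show "real_entire (\<lambda>t. ?F (x + t *\<^sub>R b))" for x b
        by (intro real_entire_add real_entire_mult real_entire_exp real_entire_const
            real_entire_lin_pred h_monomial real_entire_resp_laplace eta_monomial)
      show "AE x in D. ?F x = 0"
        using C_eq by eventually_elim (simp add: C_def \<open>\<gamma> = \<gamma>'\<close>)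
    qed
    then show ?thesis by simp
  qed
  \<comment> \<open>Stated for arbitrary parameters because it is applied in both directions, with
    \<beta> and \<beta>' exchanged.\<close>
  have match: "\<exists>k'\<in>{1..ncomp \<gamma>}. \<forall>x. b * comp_mean_M h \<eta> m \<gamma> k x = b' * comp_mean_M h \<eta> m \<gamma> k' x"
    if "\<And>x. exp (- lin_pred h a x) * resp_laplace \<eta> m \<gamma> b x
            = exp (- lin_pred h a' x) * resp_laplace \<eta> m \<gamma> b' x"
      and "k \<in> {1..ncomp \<gamma>}" for a a' b b' k
    by (rule comp_mean_M_match[where h = h and \<eta> = \<eta> and \<gamma> = \<gamma>])
      (use that h_monomial eta_monomial \<gamma>_space components_present in_space in blast)+
  obtain k0 where "k0 \<in> {1..ncomp \<gamma>}" "comp_mean_M h \<eta> m \<gamma> k0 \<noteq> (\<lambda>x. 0)"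
    using M_terms_present C2 in_space by blast
  then have "\<beta> = \<beta>'"
  proof (rule eq_if_scaled_match[rotated])
    show "0 \<le> \<beta> \<and> 0 \<le> \<beta>' \<or> \<beta> \<le> 0 \<and> \<beta>' \<le> 0 \<or>
        {comp_mean_M h \<eta> m \<gamma> i | i. i \<in> {1..ncomp \<gamma>}} \<noteq>
        {(\<lambda>x. - comp_mean_M h \<eta> m \<gamma> i x) | i. i \<in> {1..ncomp \<gamma>}}"
      using C3_or_C4 in_space by blast
  qed (use match[OF L_eq] match[OF L_eq[symmetric]] in auto)
  \<comment> \<open>With \<beta> and \<gamma> shared, the positive Laplace factor cancels and
    injectivity of \<open>exp\<close> leaves the predictors.\<close>
  have "lin_pred h \<alpha> = lin_pred h \<alpha>'"
  proof
    fix x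
    have "resp_laplace \<eta> m \<gamma> \<beta> x > 0"
      by (rule resp_laplace_pos[OF \<gamma>_space[OF in_space(3)] components_present[OF in_space(3)]])
    then show "lin_pred h \<alpha> x = lin_pred h \<alpha>' x"
      using L_eq[of x] unfolding \<open>\<beta> = \<beta>'\<close>[symmetric] by simp
  qed
  then have "\<alpha> = \<alpha>'"
    using h_injective in_space by (auto dest: inj_onD)
  with \<open>\<beta> = \<beta>'\<close> \<open>\<gamma> = \<gamma>'\<close> show "(\<alpha>, \<beta>, \<gamma>) = (\<alpha>', \<beta>', \<gamma>')" by simp
qed

end
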